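(* Let $(X,d)$ be a nonempty metric space and let $S,T,f: X\to X$ be mappings such that $SX\cup TX\subset fX$. Let $\alpha,\beta,\gamma,\delta\in[0,1)$ satisfy $\alpha+\beta+\gamma+2\delta<1$ and let $L\ge 0$. Assume that for all $x,y\in X$ $$d(Sx,Ty)\le \alpha\, d(fx,Sx)+\beta\, d(fy,Ty)+\gamma\, d(fx,fy)+\delta\,[d(fy,Sx)+d(fx,Ty)]+L\min\{d(fx,Sx),\,d(fy,Ty),\,d(fy,Sx),\,d(fx,Ty)\}.$$ If $fX$ is a complete subspace of $X$, then $S$, $T$ and $f$ have a unique point of coincidence in $X$.
   Context: For a mapping $h:X\to X$, $hX$ denotes the image $\{hx : x\in X\}$; $\subset$ allows equality; a subset of $X$ is a complete subspace if it is complete in the metric induced by $d$. A point $y\in X$ is a point of coincidence of the mappings $S,T,f:X\to X$ if there exists $x\in X$ such that $y=Sx=Tx=fx$. (Uniqueness refers to the value $y$, not to $x$.) *)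

theory Defs
  imports "HOL-Analysis.Elementary_Metric_Spaces"
begin

definition point_of_coincidence ::
    "('a \<Rightarrow> 'a) \<Rightarrow> ('a \<Rightarrow> 'a) \<Rightarrow> ('a \<Rightarrow> 'a) \<Rightarrow> 'a \<Rightarrow> bool" where
  "point_of_coincidence S T f y \<longleftrightarrow> (\<exists>x. y = S x \<and> S x = T x \<and> T x = f x)"

end

theory Submission
  imports Defs
begin

text \<open>
  The argument is Jungck's iteration with the two maps \<open>S\<close> and \<open>T\<close> taken in turn. Because both
  ranges lie in the range of \<open>f\<close>, one can choose points \<open>x n\<close> such that \<open>f (x (n + 1))\<close> is
  \<open>S (x n)\<close> for even \<open>n\<close> and \<open>T (x n)\<close> for odd \<open>n\<close>. Comparing two consecutive points makes one of
  the four distances under the minimum vanish, so the term with \<open>L\<close> disappears, however large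
  \<open>L\<close> is. What is left bounds each step of the sequence \<open>f (x n)\<close> by a fixed multiple \<open>k < 1\<close> of
  the preceding step, and \<open>geometric_steps_imp_Cauchy\<close> gives convergence to some \<open>f u\<close> in the
  complete set \<open>range f\<close>.

  Comparing \<open>u\<close> with the odd-indexed points and passing to the limit kills every term on the right
  except a multiple of \<open>dist (f u) (S u)\<close> with coefficient \<open>\<alpha> + \<delta> < 1\<close>, hence \<open>S u = f u\<close>. The
  inequality at the pair \<open>(u, u)\<close> then forces \<open>T u = f u\<close>, and the inequality at two points of
  coincidence forces them to be equal. At both of these pairs the minimum is zero again.
\<close>

lemma geometric_steps_imp_Cauchy:
  fixes s :: "nat \<Rightarrow> 'a::metric_space" and k :: real
  assumes "0 \<le> k" "k < 1"
    and step: "\<And>n. dist (s (Suc n)) (s (Suc (Suc n))) \<le> k * dist (s n) (s (Suc n))"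
  shows "Cauchy s"
proof -
  define a where "a = dist (s 0) (s 1)"
  have geo: "dist (s n) (s (Suc n)) \<le> k ^ n * a" for n
  proof (induction n)
    case (Suc n)
    have "k * dist (s n) (s (Suc n)) \<le> k * (k ^ n * a)"
      using Suc \<open>0 \<le> k\<close> by (rule mult_left_mono)
    then show ?case using step[of n] by (simp add: mult.assoc)
  qed (simp add: a_def)
  \<comment> \<open>The geometric sum from \<open>m\<close> to \<open>n\<close> telescopes after multiplication by \<open>1 - k\<close>.\<close>
  have tail: "(1 - k) * dist (s m) (s n) \<le> (k ^ m - k ^ n) * a" if "m \<le> n" for m n
    using that
  proof (induction n rule: dec_induct)
    case (step n)
    have "(1 - k) * dist (s m) (s (Suc n))
        \<le> (1 - k) * (dist (s m) (s n) + dist (s n) (s (Suc n)))"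
      using \<open>k < 1\<close> by (intro mult_left_mono dist_triangle) simp
    also have "\<dots> \<le> (k ^ m - k ^ n) * a + (1 - k) * (k ^ n * a)"
      unfolding distrib_left
      using step.IH \<open>k < 1\<close> by (intro add_mono mult_left_mono geo) auto
    also have "\<dots> = (k ^ m - k ^ Suc n) * a"
      by (simp add: algebra_simps)
    finally show ?case .
  qed simp
  show ?thesis
  proof (rule metric_CauchyI)
    fix e :: real assume "0 < e"
    have "(\<lambda>n. k ^ n * a) \<longlonglongrightarrow> 0 * a"
      using assms by (intro tendsto_mult LIMSEQ_realpow_zero tendsto_const) auto
    then have "eventually (\<lambda>n. k ^ n * a < (1 - k) * e) sequentially"
      using \<open>0 < e\<close> \<open>k < 1\<close> by (intro order_tendstoD(2)) auto
    then obtain N where N: "\<And>n. N \<le> n \<Longrightarrow> k ^ n * a < (1 - k) * e"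
      by (auto simp: eventually_sequentially)
    have close: "dist (s m) (s n) < e" if "N \<le> m" "m \<le> n" for m n
    proof -
      have "0 \<le> k ^ n * a" using \<open>0 \<le> k\<close> by (simp add: a_def)
      then have "(1 - k) * dist (s m) (s n) < (1 - k) * e"
        using tail[OF \<open>m \<le> n\<close>] N[OF \<open>N \<le> m\<close>] by (simp add: left_diff_distrib)
      then show ?thesis using \<open>k < 1\<close> by simp
    qed
    show "\<exists>M. \<forall>m\<ge>M. \<forall>n\<ge>M. dist (s m) (s n) < e"
      by (metis close dist_commute nat_le_linear)
  qed
qed

theorem theorem4:
  fixes S T f :: "'a::metric_space \<Rightarrow> 'a"
    and \<alpha> \<beta> \<gamma> \<delta> L :: real
  assumes "range S \<union> range T \<subseteq> range f"
    and "\<alpha> \<in> {0..<1}" and "\<beta> \<in> {0..<1}" and "\<gamma> \<in> {0..<1}" and "\<delta> \<in> {0..<1}"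
    and "\<alpha> + \<beta> + \<gamma> + 2 * \<delta> < 1"
    and "L \<ge> 0"
    and "\<And>x y. dist (S x) (T y) \<le>
           \<alpha> * dist (f x) (S x) + \<beta> * dist (f y) (T y) + \<gamma> * dist (f x) (f y)
           + \<delta> * (dist (f y) (S x) + dist (f x) (T y))
           + L * Min {dist (f x) (S x), dist (f y) (T y), dist (f y) (S x), dist (f x) (T y)}"
    and "complete (range f)"
  shows "\<exists>!y. point_of_coincidence S T f y"
proof -
  have nonneg: "0 \<le> \<alpha>" "0 \<le> \<beta>" "0 \<le> \<gamma>" "0 \<le> \<delta>"
    using assms(2-5) by auto
  note small = assms(6)
  \<comment> \<open>The minimum enters only through the upper bound that each of its four members gives.\<close>
  have contr: "dist (S x) (T y) \<le>
           \<alpha> * dist (f x) (S x) + \<beta> * dist (f y) (T y) + \<gamma> * dist (f x) (f y)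
           + \<delta> * (dist (f y) (S x) + dist (f x) (T y)) + L * t"
    if "t \<in> {dist (f x) (S x), dist (f y) (T y), dist (f y) (S x), dist (f x) (T y)}" for x y t
  proof -
    have "Min {dist (f x) (S x), dist (f y) (T y), dist (f y) (S x), dist (f x) (T y)} \<le> t"
      using that by (intro Min_le) auto
    from mult_left_mono[OF this \<open>L \<ge> 0\<close>] assms(8)[of x y] show ?thesis
      by linarith
  qed

  have "\<exists>b. f b = (if even n then S a else T a)" for n :: nat and a
  proof -
    have "(if even n then S a else T a) \<in> range f" using assms(1) by auto
    then show ?thesis by (metis imageE)
  qed
  then obtain x where x: "\<And>n. f (x (Suc n)) = (if even n then S (x n) else T (x n))"
    using dependent_nat_choice[of "\<lambda>_ _. True" "\<lambda>n a b. f b = (if even n then S a else T a)"]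
    by auto
  define s where "s n = f (x n)" for n
  have sS: "S (x n) = s (Suc n)" if "even n" for n using x that by (simp add: s_def)
  have sT: "T (x n) = s (Suc n)" if "odd n" for n using x that by (simp add: s_def)

  \<comment> \<open>The two ratios arise from solving the inequality for the newer step, which also occurs on the
    right-hand side: with weight \<open>\<beta> + \<delta>\<close> if it was made by \<open>T\<close>, and \<open>\<alpha> + \<delta>\<close> if made by \<open>S\<close>.\<close>
  define p where "p = (\<alpha> + \<gamma> + \<delta>) / (1 - \<beta> - \<delta>)"
  define q where "q = (\<beta> + \<gamma> + \<delta>) / (1 - \<alpha> - \<delta>)"
  define k where "k = max p q"
  have pos: "0 < 1 - \<beta> - \<delta>" "0 < 1 - \<alpha> - \<delta>" using nonneg small by linarith+
  have k: "0 \<le> k" "k < 1"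
    using pos nonneg small by (auto simp: k_def p_def q_def le_max_iff_disj)
  have step: "dist (s (Suc n)) (s (Suc (Suc n))) \<le> k * dist (s n) (s (Suc n))" for n
  proof -
    let ?a = "dist (s n) (s (Suc n))" and ?b = "dist (s (Suc n)) (s (Suc (Suc n)))"
    have tri: "\<delta> * dist (s n) (s (Suc (Suc n))) \<le> \<delta> * (?a + ?b)"
      using nonneg by (intro mult_left_mono dist_triangle)
    show ?thesis
    proof (cases "even n")
      case True
      have "?b \<le> \<alpha> * ?a + \<beta> * ?b + \<gamma> * ?a + \<delta> * dist (s n) (s (Suc (Suc n)))"
        using contr[of 0 "x n" "x (Suc n)"] True by (simp add: sS sT flip: s_def)
      with tri have "(1 - \<beta> - \<delta>) * ?b \<le> (\<alpha> + \<gamma> + \<delta>) * ?a"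
        by (simp add: algebra_simps)
      then have "?b \<le> p * ?a" using pos by (simp add: p_def field_simps)
      also have "\<dots> \<le> k * ?a" by (intro mult_right_mono) (auto simp: k_def)
      finally show ?thesis .
    next
      case False
      have "?b \<le> \<alpha> * ?b + \<beta> * ?a + \<gamma> * ?a + \<delta> * dist (s n) (s (Suc (Suc n)))"
        using contr[of 0 "x (Suc n)" "x n"] False
        by (simp add: sS sT dist_commute flip: s_def)
      with tri have "(1 - \<alpha> - \<delta>) * ?b \<le> (\<beta> + \<gamma> + \<delta>) * ?a"
        by (simp add: algebra_simps)
      then have "?b \<le> q * ?a" using pos by (simp add: q_def field_simps)
      also have "\<dots> \<le> k * ?a" by (intro mult_right_mono) (auto simp: k_def)
      finally show ?thesis .
    qed
  qed
  have "Cauchy s" using k step by (rule geometric_steps_imp_Cauchy)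
  moreover have "\<forall>n. s n \<in> range f" by (simp add: s_def)
  ultimately obtain u where u: "s \<longlonglongrightarrow> f u"
    using \<open>complete (range f)\<close> unfolding complete_def by blast

  have Su: "S u = f u"
  proof -
    have odd_lim: "(\<lambda>n. s (2 * n + 1)) \<longlonglongrightarrow> f u" and even_lim: "(\<lambda>n. s (2 * n + 2)) \<longlonglongrightarrow> f u"
      by (rule LIMSEQ_subseq_LIMSEQ[OF u, unfolded o_def], simp add: strict_mono_def)+
    \<comment> \<open>Of the four members of the minimum, the one used here tends to zero.\<close>
    have ineq: "dist (S u) (s (2 * n + 2)) \<le> \<alpha> * dist (f u) (S u)
        + \<beta> * dist (s (2 * n + 1)) (s (2 * n + 2)) + \<gamma> * dist (f u) (s (2 * n + 1))
        + \<delta> * (dist (s (2 * n + 1)) (S u) + dist (f u) (s (2 * n + 2)))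
        + L * dist (f u) (s (2 * n + 2))" for n
      using contr[of "dist (f u) (s (2 * n + 2))" u "x (2 * n + 1)"]
      by (simp add: sT flip: s_def)
    have "dist (S u) (f u) \<le> \<alpha> * dist (f u) (S u) + \<beta> * dist (f u) (f u) + \<gamma> * dist (f u) (f u)
        + \<delta> * (dist (f u) (S u) + dist (f u) (f u)) + L * dist (f u) (f u)"
    proof (rule LIMSEQ_le)
      show "(\<lambda>n. dist (S u) (s (2 * n + 2))) \<longlonglongrightarrow> dist (S u) (f u)"
        by (intro tendsto_intros even_lim)
    next
      show "(\<lambda>n. \<alpha> * dist (f u) (S u)
          + \<beta> * dist (s (2 * n + 1)) (s (2 * n + 2)) + \<gamma> * dist (f u) (s (2 * n + 1))
          + \<delta> * (dist (s (2 * n + 1)) (S u) + dist (f u) (s (2 * n + 2)))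
          + L * dist (f u) (s (2 * n + 2)))
        \<longlonglongrightarrow> \<alpha> * dist (f u) (S u) + \<beta> * dist (f u) (f u) + \<gamma> * dist (f u) (f u)
          + \<delta> * (dist (f u) (S u) + dist (f u) (f u)) + L * dist (f u) (f u)"
        by (intro tendsto_intros odd_lim even_lim)
    qed (use ineq in blast)
    then have "(1 - \<alpha> - \<delta>) * dist (S u) (f u) \<le> 0"
      by (simp add: algebra_simps dist_commute)
    then show ?thesis using pos by (simp add: mult_le_0_iff)
  qed
  have Tu: "T u = f u"
  proof -
    have "(1 - \<beta> - \<delta>) * dist (f u) (T u) \<le> 0"
      using contr[of 0 u u] by (simp add: Su algebra_simps)
    then show ?thesis using pos by (simp add: mult_le_0_iff)
  qed

  show ?thesis
  proof (rule ex1I)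
    show "point_of_coincidence S T f (f u)"
      using Su Tu unfolding point_of_coincidence_def by metis
  next
    fix y assume "point_of_coincidence S T f y"
    then obtain v where v: "y = f v" "S v = f v" "T v = f v"
      unfolding point_of_coincidence_def by metis
    have "(1 - \<gamma> - 2 * \<delta>) * dist (f v) (f u) \<le> 0"
      using contr[of 0 v u] by (simp add: v Su Tu algebra_simps dist_commute)
    moreover have "0 < 1 - \<gamma> - 2 * \<delta>" using nonneg small by linarith
    ultimately show "y = f u" using v by (simp add: mult_le_0_iff)
  qed
qed

end
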